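(* $c_{\mathrm{sc}}(6)=7$. In particular, the six-vertex digraph $D_0$ that is the disjoint union (with no arcs between the two parts) of a bidirected triangle $\overleftrightarrow{K}_3$ (three vertices with all six ordered pairs of distinct vertices as arcs) and a consistently directed path $x\to y\to z$ on three further vertices (whose only arcs are $(x,y)$ and $(y,z)$) has eight arcs and is not completable.
   Context: All digraphs are finite and loopless; opposite arcs $(u,v)$ and $(v,u)$ may both be present, but repeated arcs are not allowed. The complement $\overline D$ of a digraph $D$ has the same vertex set as $D$, and an ordered pair of distinct vertices is an arc of $\overline D$ exactly when it is not an arc of $D$. A digraph is self-complementary if it is isomorphic to its complement. An $n$-vertex digraph $D$ is completable if it is isomorphic to a spanning subdigraph of some self-complementary digraph of the same order $n$ (no new vertices may be added). For a positive integer $n$, $$c_{\mathrm{sc}}(n)=\max\{q : \text{every } n\text{-vertex digraph with at most } q \text{ arcs is completable}\}.$$ *)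

theory Defs
  imports "Graph_Theory.Graph_Theory"
begin

text \<open>
  Digraphs are the \<^typ>\<open>'a pair_pre_digraph\<close>s satisfying \<^locale>\<open>pair_digraph\<close>: finite and loopless,
  with arcs given by a set of ordered pairs of vertices. The notions \<^const>\<open>digraph_iso\<close> and
  \<^const>\<open>spanning\<close> apply to them through \<^const>\<open>with_proj\<close>.
\<close>

definition complement_digraph :: "'a pair_pre_digraph \<Rightarrow> 'a pair_pre_digraph" where
  "complement_digraph D =
    \<lparr> pverts = pverts D,
      parcs = {(u, v). u \<in> pverts D \<and> v \<in> pverts D \<and> u \<noteq> v \<and> (u, v) \<notin> parcs D} \<rparr>"

definition self_complementary :: "'a pair_pre_digraph \<Rightarrow> bool" where
  "self_complementary D \<longleftrightarrow> digraph_iso (with_proj D) (with_proj (complement_digraph D))"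

text \<open>
  \<open>D'\<close> and \<open>H\<close> have the same vertex set, so \<open>H\<close> automatically has the same order as \<open>D\<close>.
  Taking \<open>H\<close> over the vertex type of \<open>D\<close> is no restriction, since any digraph of the same order
  has an isomorphic copy on the vertices of \<open>D\<close>.
\<close>

definition completable :: "'a pair_pre_digraph \<Rightarrow> bool" where
  "completable D \<longleftrightarrow>
    (\<exists>H D' :: 'a pair_pre_digraph. pair_digraph H \<and> self_complementary H \<and>
      spanning (with_proj D') (with_proj H) \<and> digraph_iso (with_proj D) (with_proj D'))"

text \<open>
  Up to isomorphism every \<open>n\<close>-vertex digraph has natural numbers as vertices. For \<open>n \<le> 1\<close> the set
  below is unbounded (all such digraphs are completable), so the maximum is meaningful only
  for \<open>n \<ge> 2\<close>.
\<close>

definition c_sc :: "nat \<Rightarrow> nat" where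
  "c_sc n = Max {q. \<forall>D :: nat pair_pre_digraph.
     pair_digraph D \<and> card (pverts D) = n \<and> card (parcs D) \<le> q \<longrightarrow> completable D}"

text \<open>
  Bidirected triangle on \<open>a, b, c\<close> together with the directed path \<open>x, y, z\<close>; the intended
  digraph arises when the six vertices are distinct.
\<close>

definition triangle_path :: "'a \<Rightarrow> 'a \<Rightarrow> 'a \<Rightarrow> 'a \<Rightarrow> 'a \<Rightarrow> 'a \<Rightarrow> 'a pair_pre_digraph" where
  "triangle_path a b c x y z =
    \<lparr> pverts = {a, b, c} \<union> {x, y, z},
      parcs = {(a, b), (b, a), (a, c), (c, a), (b, c), (c, b)} \<union> {(x, y), (y, z)} \<rparr>"

end

theory Submission
  imports Defs
begin

text \<open>
  An isomorphism from \<open>H\<close> to its complement is a vertex permutation \<open>s\<close> exchanging arcs and non-arcs.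
  If \<open>s\<close> has order dividing 4 and moves every ordered pair of distinct vertices, then \<open>D\<close>
  extends to such an \<open>H\<close> as soon as no arc of \<open>D\<close> is mapped by \<open>s\<close> to an arc of \<open>D\<close>.
  For six vertices and at most seven arcs a suitable \<open>s\<close> always exists among the permutations of
  cycle types 2+2+2 and 4+2: a set of arcs spoiling all of them must contain, for each, one of its
  few bad pairs, and branching over these pairs exhausts the seven arcs.

  For the triangle with a path, \<open>s\<close> and its inverse must both send two triangle vertices to the ends
  \<open>x\<close>, \<open>z\<close> of the path and none to \<open>y\<close>. This forces \<open>s\<close> to fix \<open>y\<close>, so \<open>y\<close> has as many out-neighbours
  as out-non-neighbours among the other five vertices, which is absurd.
\<close>

section \<open>Isomorphism and completability in terms of vertex maps\<close>

text \<open>Both digraphs have \<open>fst\<close> and \<open>snd\<close> as tail and head maps, so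
  the action of an isomorphism on arcs is determined by its action on vertices.\<close>

lemma digraph_iso_with_proj_iff:
  assumes "pair_wf_digraph G"
  shows "digraph_iso (with_proj G) (with_proj H) \<longleftrightarrow>
    (\<exists>f. inj_on f (pverts G) \<and> pverts H = f ` pverts G \<and> parcs H = map_prod f f ` parcs G)"
proof
  assume "digraph_iso (with_proj G) (with_proj H)"
  then obtain h where h: "pre_digraph.digraph_isomorphism (with_proj G) h"
    and H: "with_proj H = app_iso h (with_proj G)"
    by (auto simp: digraph_iso_def)
  have ht: "iso_tail h = fst" "iso_head h = snd"
    using H by (auto simp: with_proj_def app_iso_def)
  have "iso_arcs h e = map_prod (iso_verts h) (iso_verts h) e" if "e \<in> parcs G" for e
    using h that ht unfolding pre_digraph.digraph_isomorphism_def
    by (auto simp: prod_eq_iff)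
  then have "iso_arcs h ` parcs G = map_prod (iso_verts h) (iso_verts h) ` parcs G"
    by (intro image_cong) auto
  then show "\<exists>f. inj_on f (pverts G) \<and> pverts H = f ` pverts G \<and> parcs H = map_prod f f ` parcs G"
    using h H unfolding pre_digraph.digraph_isomorphism_def
    by (intro exI[of _ "iso_verts h"]) (auto simp: with_proj_def app_iso_def)
next
  assume "\<exists>f. inj_on f (pverts G) \<and> pverts H = f ` pverts G \<and> parcs H = map_prod f f ` parcs G"
  then obtain f where f: "inj_on f (pverts G)" "pverts H = f ` pverts G"
    "parcs H = map_prod f f ` parcs G"
    by auto
  interpret pair_wf_digraph G by fact
  have "inj_on (map_prod f f) (parcs G)"
    by (rule inj_on_subset[OF map_prod_inj_on[OF f(1) f(1)]]) (auto dest: in_arcsD1 in_arcsD2)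
  then have "pre_digraph.digraph_isomorphism (with_proj G)
      \<lparr>iso_verts = f, iso_arcs = map_prod f f, iso_head = snd, iso_tail = fst\<rparr>"
    using assms f(1) by (auto simp: pre_digraph.digraph_isomorphism_def wf_digraph_wp_iff)
  moreover have "with_proj H = app_iso
      \<lparr>iso_verts = f, iso_arcs = map_prod f f, iso_head = snd, iso_tail = fst\<rparr> (with_proj G)"
    using f(2,3) by (simp add: with_proj_def app_iso_def)
  ultimately show "digraph_iso (with_proj G) (with_proj H)"
    unfolding digraph_iso_def by blast
qed

text \<open>Only distinct pairs inside \<open>V\<close> are tested, so \<open>E\<close> may be any
  relation, for instance a preimage of an arc set, without first being trimmed to
  \<open>V\<close>.\<close>

definition antimorphism :: "'a set \<Rightarrow> ('a \<times> 'a) set \<Rightarrow> ('a \<Rightarrow> 'a) \<Rightarrow> bool" where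
  "antimorphism V E s \<longleftrightarrow> bij_betw s V V \<and>
    (\<forall>u\<in>V. \<forall>v\<in>V. u \<noteq> v \<longrightarrow> ((s u, s v) \<in> E \<longleftrightarrow> (u, v) \<notin> E))"

lemma antimorphism_the_inv_into:
  assumes "antimorphism V E s"
  shows "antimorphism V E (the_inv_into V s)"
proof -
  let ?t = "the_inv_into V s"
  have s: "bij_betw s V V" using assms by (simp add: antimorphism_def)
  then have t: "bij_betw ?t V V" by (rule bij_betw_the_inv_into)
  have "(?t u, ?t v) \<in> E \<longleftrightarrow> (u, v) \<notin> E" if "u \<in> V" "v \<in> V" "u \<noteq> v" for u v
  proof -
    have "s (?t u) = u" "s (?t v) = v" "?t u \<in> V" "?t v \<in> V"
      using s t that by (auto simp: f_the_inv_into_f_bij_betw bij_betw_apply)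
    then show ?thesis
      using assms that unfolding antimorphism_def by metis
  qed
  with t show ?thesis by (auto simp: antimorphism_def)
qed

lemma completableD:
  fixes D :: "'a pair_pre_digraph"
  assumes "pair_wf_digraph D" "completable D"
  shows "\<exists>E s. parcs D \<subseteq> E \<and> antimorphism (pverts D) E s"
proof -
  obtain H D' :: "'a pair_pre_digraph" where H: "pair_digraph H" "self_complementary H"
    and D': "spanning (with_proj D') (with_proj H)" "digraph_iso (with_proj D) (with_proj D')"
    using assms(2) by (auto simp: completable_def)
  interpret H: pair_digraph H by fact
  obtain f where f: "inj_on f (pverts D)" "pverts D' = f ` pverts D"
    "parcs D' = map_prod f f ` parcs D"
    using D'(2) unfolding digraph_iso_with_proj_iff[OF assms(1)] by (elim exE conjE)
  have sub: "pverts H = f ` pverts D" "map_prod f f ` parcs D \<subseteq> parcs H"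
    using D'(1) f by (auto simp: spanning_def subgraph_def)
  obtain r where r: "inj_on r (pverts H)" "pverts H = r ` pverts H"
    "parcs (complement_digraph H) = map_prod r r ` parcs H"
    using H(2) unfolding self_complementary_def digraph_iso_with_proj_iff[OF H.pair_wf_digraph_axioms]
    by (elim exE conjE) (simp add: complement_digraph_def)
  define g where "g = the_inv_into (pverts D) f"
  have fb: "bij_betw f (pverts D) (pverts H)"
    using f(1) sub(1) by (auto simp: bij_betw_def)
  have gb: "bij_betw g (pverts H) (pverts D)"
    unfolding g_def using fb by (rule bij_betw_the_inv_into)
  have rb: "bij_betw r (pverts H) (pverts H)"
    using r by (auto simp: bij_betw_def)
  have fg: "f (g x) = x" if "x \<in> pverts H" for x
    unfolding g_def using fb that by (rule f_the_inv_into_f_bij_betw)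
  have r_arc: "(r x, r y) \<in> parcs H \<longleftrightarrow> (x, y) \<notin> parcs H"
    if xy: "x \<in> pverts H" "y \<in> pverts H" "x \<noteq> y" for x y
  proof -
    have "r x \<in> pverts H" "r y \<in> pverts H" "r x \<noteq> r y"
      using xy rb by (auto simp: bij_betw_def inj_on_def)
    then have "(r x, r y) \<notin> parcs H \<longleftrightarrow> (r x, r y) \<in> map_prod r r ` parcs H"
      unfolding r(3)[symmetric] by (simp add: complement_digraph_def)
    also have "\<dots> \<longleftrightarrow> (x, y) \<in> parcs H"
      using xy r(1) by (auto dest: H.in_arcsD1 H.in_arcsD2 inj_onD)
    finally show ?thesis by blast
  qed
  \<comment> \<open>The arcs of \<open>H\<close> are pulled back along \<open>f\<close>, and
    \<open>r\<close> is conjugated by \<open>f\<close>.\<close>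
  let ?E = "{(u, v). (f u, f v) \<in> parcs H}" and ?s = "g \<circ> r \<circ> f"
  have "bij_betw ?s (pverts D) (pverts D)"
    using fb rb gb by (auto intro: bij_betw_trans simp: comp_assoc)
  moreover have "(?s u, ?s v) \<in> ?E \<longleftrightarrow> (u, v) \<notin> ?E"
    if uv: "u \<in> pverts D" "v \<in> pverts D" "u \<noteq> v" for u v
  proof -
    have "f u \<in> pverts H" "f v \<in> pverts H" "f u \<noteq> f v"
      using uv f(1) sub(1) by (auto dest: inj_onD)
    moreover from this have "f (?s u) = r (f u)" "f (?s v) = r (f v)"
      using rb fg by (auto simp: bij_betw_apply)
    ultimately show ?thesis using r_arc by simp
  qed
  ultimately have "antimorphism (pverts D) ?E ?s"
    by (auto simp: antimorphism_def)
  moreover have "parcs D \<subseteq> ?E" using sub(2) by auto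
  ultimately show ?thesis by blast
qed

text \<open>Discarding loops and pairs outside the vertex set turns \<open>E\<close> into a
  self-complementary \<open>H\<close> in which \<open>D\<close> itself is spanning.\<close>

lemma completableI:
  assumes D: "pair_digraph D" and sub: "parcs D \<subseteq> E" and s: "antimorphism (pverts D) E s"
  shows "completable D"
proof -
  let ?V = "pverts D"
  define H where "H = \<lparr>pverts = ?V, parcs = {(u, v) \<in> E. u \<in> ?V \<and> v \<in> ?V \<and> u \<noteq> v}\<rparr>"
  interpret D: pair_digraph D by fact
  have H: "pair_digraph H"
    using D.pair_finite_verts
    by unfold_locales (auto simp: H_def intro: finite_subset[of _ "?V \<times> ?V"])
  interpret H: pair_digraph H by fact
  have sb: "bij_betw s ?V ?V"
    and se: "\<And>u v. u \<in> ?V \<Longrightarrow> v \<in> ?V \<Longrightarrow> u \<noteq> v \<Longrightarrow> (s u, s v) \<in> E \<longleftrightarrow> (u, v) \<notin> E"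
    using s by (auto simp: antimorphism_def)
  have "(x, y) \<in> map_prod s s ` parcs H"
    if xy: "x \<in> ?V" "y \<in> ?V" "x \<noteq> y" "(x, y) \<notin> E" for x y
  proof -
    obtain u v where "u \<in> ?V" "v \<in> ?V" "x = s u" "y = s v"
      using xy sb by (metis bij_betw_imp_surj_on imageE)
    with xy se[of u v] show ?thesis by (force simp: H_def)
  qed
  moreover have "s u \<in> ?V" "s v \<in> ?V" "s u \<noteq> s v" "(s u, s v) \<notin> E" if "(u, v) \<in> parcs H" for u v
    using that se[of u v] sb by (auto simp: H_def bij_betw_def inj_on_def)
  ultimately have "parcs (complement_digraph H) = map_prod s s ` parcs H"
    by (auto simp: complement_digraph_def H_def)
  then have "self_complementary H"
    using sb unfolding self_complementary_def digraph_iso_with_proj_iff[OF H.pair_wf_digraph_axioms]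
    by (intro exI[of _ s]) (simp add: bij_betw_def complement_digraph_def H_def)
  moreover have "spanning (with_proj D) (with_proj H)"
    using sub D.pair_wf_digraph_axioms H.pair_wf_digraph_axioms D.pair_no_loops
    by (fastforce simp: spanning_def subgraph_def wf_digraph_wp_iff H_def
        dest: D.in_arcsD1 D.in_arcsD2)
  moreover have "digraph_iso (with_proj D) (with_proj D)"
    unfolding digraph_iso_with_proj_iff[OF D.pair_wf_digraph_axioms]
    by (intro exI[of _ id]) (auto simp: map_prod_def)
  ultimately show ?thesis
    using H unfolding completable_def by blast
qed

section \<open>Extension along permutations of order dividing 4\<close>

text \<open>On pairs of distinct vertices \<open>s\<close> has only cycles of length 2 and 4. In
  such a cycle a maximal set without two consecutive elements takes every other element, which is
  exactly what an antimorphism requires; a cycle of length 6 would already violate this.\<close>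

lemma completable_if_order4:
  assumes D: "pair_digraph D"
    and s: "\<And>v. v \<in> pverts D \<Longrightarrow> s v \<in> pverts D" "\<And>v. v \<in> pverts D \<Longrightarrow> s (s (s (s v))) = v"
    and nofix: "\<And>u v. u \<in> pverts D \<Longrightarrow> v \<in> pverts D \<Longrightarrow> u \<noteq> v \<Longrightarrow> s u \<noteq> u \<or> s v \<noteq> v"
    and good: "\<And>u v. (u, v) \<in> parcs D \<Longrightarrow> (s u, s v) \<notin> parcs D"
  shows "completable D"
proof -
  interpret D: pair_digraph D by fact
  let ?V = "pverts D"
  have sb: "bij_betw s ?V ?V"
    by (rule bij_betw_byWitness[where f' = "\<lambda>v. s (s (s v))"]) (use s in auto)
  then have s_eq: "s u = s v \<longleftrightarrow> u = v" if "u \<in> ?V" "v \<in> ?V" for u v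
    using that by (auto simp: bij_betw_def inj_on_def)
  let ?g = "map_prod s s"
  define A where "A = {(u, v). u \<in> ?V \<and> v \<in> ?V \<and> u \<noteq> v}"
  have g: "?g e \<in> A" "?g (?g (?g (?g e))) = e" "?g e \<noteq> e" if "e \<in> A" for e
  proof -
    obtain u v where e: "e = (u, v)" "u \<in> ?V" "v \<in> ?V" "u \<noteq> v"
      using \<open>e \<in> A\<close> by (auto simp: A_def)
    then show "?g e \<in> A" by (simp add: A_def s(1) s_eq)
    show "?g (?g (?g (?g e))) = e" by (simp add: e s(2))
    show "?g e \<noteq> e" using nofix[OF e(2-4)] e(1) by auto
  qed
  \<comment> \<open>a set maximal in \<open>F\<close> contains exactly one of \<open>e\<close>, \<open>s e\<close> for each arc \<open>e\<close>\<close>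
  define F where "F = {E. parcs D \<subseteq> E \<and> E \<subseteq> A \<and> (\<forall>e\<in>E. ?g e \<notin> E)}"
  have "finite A"
    using D.pair_finite_verts by (auto simp: A_def intro: finite_subset[of _ "?V \<times> ?V"])
  then have "finite F"
    by (auto simp: F_def intro: finite_subset[of _ "Pow A"])
  moreover have "parcs D \<in> F"
    using good D.pair_no_loops by (fastforce simp: F_def A_def dest: D.in_arcsD1 D.in_arcsD2)
  ultimately obtain E where E: "E \<in> F" "parcs D \<subseteq> E" and maxE: "\<And>E'. E' \<in> F \<Longrightarrow> E \<subseteq> E' \<Longrightarrow> E' = E"
    using finite_has_maximal2[of F "parcs D"] by metis
  \<comment> \<open>By order 4 the threefold image of \<open>e\<close> is its predecessor. If
    neither neighbour of \<open>e\<close> in its cycle were in \<open>E\<close>, adding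
    \<open>e\<close> would contradict maximality.\<close>
  have block: "?g e \<in> E \<or> ?g (?g (?g e)) \<in> E" if "e \<in> A" "e \<notin> E" for e
  proof (rule ccontr)
    assume *: "\<not> ?thesis"
    have "?g e' \<noteq> e" if "e' \<in> E" for e'
    proof
      assume "?g e' = e"
      then have "?g (?g (?g e)) = e'" using that E(1) g(2)[of e'] by (auto simp: F_def)
      with * that show False by auto
    qed
    then have "insert e E \<in> F"
      using E(1) that * g(3)[OF that(1)] by (auto simp: F_def)
    with maxE[of "insert e E"] that show False by auto
  qed
  have "?g e \<in> E \<longleftrightarrow> e \<notin> E" if "e \<in> A" for e
  proof
    show "?g e \<in> E \<Longrightarrow> e \<notin> E" using E(1) by (auto simp: F_def)
    assume "e \<notin> E"
    show "?g e \<in> E"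
    proof (rule ccontr)
      assume n: "?g e \<notin> E"
      then have "?g (?g (?g e)) \<in> E" using block[OF that] \<open>e \<notin> E\<close> by auto
      moreover have "?g (?g e) \<in> E"
        using block[OF g(1)[OF that] n] g(2)[OF that] \<open>e \<notin> E\<close> by auto
      \<comment> \<open>Two consecutive elements, \<open>?g (?g e)\<close> and its image, would both
        lie in \<open>E\<close>.\<close>
      ultimately show False using E(1) unfolding F_def by blast
    qed
  qed
  then have "antimorphism ?V E s"
    using sb by (auto simp: antimorphism_def A_def)
  with D E(2) show ?thesis by (rule completableI)
qed

section \<open>Non-completability of the triangle with a path\<close>

text \<open>At a fixed point \<open>y\<close>, \<open>s\<close> maps the out-neighbours of
  \<open>y\<close> bijectively onto the remaining vertices other than \<open>y\<close>, so removing
  \<open>y\<close> leaves an even number of vertices.\<close>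

lemma antimorphism_no_fixed_point:
  assumes "antimorphism V E s" "finite V" "even (card V)" "y \<in> V"
  shows "s y \<noteq> y"
proof
  assume y: "s y = y"
  have sb: "bij_betw s V V"
    and se: "\<And>u v. u \<in> V \<Longrightarrow> v \<in> V \<Longrightarrow> u \<noteq> v \<Longrightarrow> (s u, s v) \<in> E \<longleftrightarrow> (u, v) \<notin> E"
    using assms(1) by (auto simp: antimorphism_def)
  let ?W = "V - {y}"
  let ?N = "{v \<in> ?W. (y, v) \<in> E}" and ?M = "{v \<in> ?W. (y, v) \<notin> E}"
  have sW: "bij_betw s ?W ?W"
    using sb y assms(4) bij_betw_DiffI[of s V V "{y}" "{y}"] by auto
  have "s ` ?N = ?M"
  proof
    show "s ` ?N \<subseteq> ?M"
      using se[OF assms(4)] y sW by (auto dest: bij_betw_apply)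
    show "?M \<subseteq> s ` ?N"
    proof
      fix v assume v: "v \<in> ?M"
      then obtain u where u: "u \<in> ?W" "v = s u"
        using sW by (auto simp: bij_betw_def)
      with v se[OF assms(4), of u] y show "v \<in> s ` ?N" by auto
    qed
  qed
  moreover have "inj_on s ?N"
    using sW by (auto simp: bij_betw_def intro: inj_on_subset)
  ultimately have "card ?M = card ?N"
    by (metis (no_types, lifting) card_image)
  moreover have "card (?N \<union> ?M) = card ?N + card ?M"
    using assms(2) by (intro card_Un_disjoint) auto
  moreover have "?N \<union> ?M = ?W" by blast
  moreover have "card V = Suc (card ?W)"
    using card_Suc_Diff1[OF assms(2,4)] by (rule sym)
  ultimately have "card V = Suc (card ?N + card ?N)" by simp
  then show False using assms(3) by auto
qed

text \<open>The images of the triangle vertices are pairwise without arcs of \<open>E\<close> in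
  either direction. So at most one lies in the triangle, and \<open>y\<close>, adjacent to both
  \<open>x\<close> and \<open>z\<close>, cannot occur with either of them.\<close>

lemma antimorphism_triangle_path_image:
  assumes dist: "distinct [a, b, c, x, y, z]"
    and D: "parcs (triangle_path a b c x y z) \<subseteq> E"
    and s: "antimorphism (pverts (triangle_path a b c x y z)) E s"
  shows "s ` {a, b, c} \<inter> {x, y, z} = {x, z}"
proof -
  let ?T = "{a, b, c}" and ?V = "pverts (triangle_path a b c x y z)"
  have V: "?V = ?T \<union> {x, y, z}" by (simp add: triangle_path_def)
  have sb: "bij_betw s ?V ?V"
    and se: "\<And>u v. u \<in> ?V \<Longrightarrow> v \<in> ?V \<Longrightarrow> u \<noteq> v \<Longrightarrow> (s u, s v) \<in> E \<longleftrightarrow> (u, v) \<notin> E"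
    using s by (auto simp: antimorphism_def)
  have mem: "s u \<in> ?T \<or> s u = x \<or> s u = y \<or> s u = z" if "u \<in> ?T" for u
    using bij_betwE[OF sb] that unfolding V by blast
  have tri: "(u, v) \<in> parcs (triangle_path a b c x y z)" if "u \<in> ?T" "v \<in> ?T" "u \<noteq> v" for u v
    using that by (auto simp: triangle_path_def)
  have path: "(x, y) \<in> parcs (triangle_path a b c x y z)" "(y, z) \<in> parcs (triangle_path a b c x y z)"
    by (auto simp: triangle_path_def)
  have pair: "s u \<noteq> s v" "\<not> (s u \<in> ?T \<and> s v \<in> ?T)" "\<not> (s u = y \<and> (s v = x \<or> s v = z))"
    if "u \<in> ?T" "v \<in> ?T" "u \<noteq> v" for u v
  proof -
    have uv: "u \<in> ?V" "v \<in> ?V" using that unfolding V by blast+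
    show neq: "s u \<noteq> s v" using sb uv that(3) by (auto simp: bij_betw_def dest: inj_onD)
    have "(s u, s v) \<notin> E" "(s v, s u) \<notin> E"
      using se[OF uv] se[OF uv(2,1)] tri[OF that] tri[OF that(2,1)] that(3) D by auto
    then show "\<not> (s u \<in> ?T \<and> s v \<in> ?T)" "\<not> (s u = y \<and> (s v = x \<or> s v = z))"
      using tri[of "s u" "s v"] neq path D by auto
  qed
  \<comment> \<open>If \<open>s u = y\<close>, the other two images would both be forced into the
    triangle.\<close>
  have ex: "s u \<noteq> y \<and> (s u \<in> ?T \<longrightarrow> s v = x \<and> s w = z \<or> s v = z \<and> s w = x)"
    if "u \<in> ?T" "v \<in> ?T" "w \<in> ?T" "u \<noteq> v" "u \<noteq> w" "v \<noteq> w" for u v w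
    using mem[OF that(2)] mem[OF that(3)] pair[OF that(1,2,4)] pair[OF that(1,3,5)]
      pair[OF that(2,3,6)] pair[OF that(2,1) that(4)[symmetric]] pair[OF that(3,1) that(5)[symmetric]]
      pair[OF that(3,2) that(6)[symmetric]]
    by metis
  have T: "a \<in> ?T" "b \<in> ?T" "c \<in> ?T" by simp_all
  have ne: "a \<noteq> b" "a \<noteq> c" "b \<noteq> c" using dist by simp_all
  note abc = ex[OF T(1,2,3) ne]
    and bac = ex[OF T(2,1,3) ne(1)[symmetric] ne(3) ne(2)]
    and cab = ex[OF T(3,1,2) ne(2)[symmetric] ne(3)[symmetric] ne(1)]
  \<comment> \<open>Otherwise three distinct images would have to fit into
    \<open>{x, z}\<close>.\<close>
  have "s a \<in> ?T \<or> s b \<in> ?T \<or> s c \<in> ?T"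
    using mem[OF T(1)] mem[OF T(2)] mem[OF T(3)] abc bac cab
      pair(1)[OF T(1,2) ne(1)] pair(1)[OF T(1,3) ne(2)] pair(1)[OF T(2,3) ne(3)]
    by metis
  then have "x \<in> s ` ?T" "z \<in> s ` ?T"
    using abc bac cab by (elim disjE; force)+
  moreover have "y \<notin> s ` ?T" using abc bac cab by blast
  ultimately show ?thesis by blast
qed

lemma not_completable_triangle_path:
  assumes dist: "distinct [a, b, c, x, y, z]"
  shows "\<not> completable (triangle_path a b c x y z)"
proof
  let ?D = "triangle_path a b c x y z"
  have V: "pverts ?D = {a, b, c, x, y, z}" by (auto simp: triangle_path_def)
  assume "completable ?D"
  moreover have "pair_wf_digraph ?D"
    by unfold_locales (auto simp: triangle_path_def)
  ultimately obtain E s where E: "parcs ?D \<subseteq> E" and s: "antimorphism (pverts ?D) E s"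
    using completableD by blast
  have sb: "bij_betw s (pverts ?D) (pverts ?D)" using s by (simp add: antimorphism_def)
  let ?t = "the_inv_into (pverts ?D) s"
  have ne: "y \<noteq> x" "y \<noteq> z" and yT: "y \<notin> {a, b, c}" using dist by auto
  have "x \<in> s ` {a, b, c}" "z \<in> s ` {a, b, c}"
    using antimorphism_triangle_path_image[OF dist E s] by blast+
  moreover have "s y \<notin> s ` {a, b, c}"
    using sb yT by (subst inj_on_image_mem_iff[of s "pverts ?D"]) (auto simp: V bij_betw_def)
  ultimately have "s y \<noteq> x" "s y \<noteq> z" by auto
  \<comment> \<open>The image lemma for the inverse: a triangle vertex \<open>s y\<close> would be
    sent back to \<open>y\<close>.\<close>
  moreover have "y \<notin> ?t ` {a, b, c}"
    using antimorphism_triangle_path_image[OF dist E antimorphism_the_inv_into[OF s]] ne by blast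
  moreover have "?t (s y) = y"
    using sb by (intro the_inv_into_f_f) (simp_all add: bij_betw_def V)
  ultimately have "s y \<noteq> x" "s y \<noteq> z" "s y \<notin> {a, b, c}" by (auto dest: imageI[of _ _ ?t])
  moreover have "s y \<in> pverts ?D" using bij_betwE[OF sb] by (simp add: V)
  ultimately have "s y = y" by (auto simp: V)
  then show False
    using antimorphism_no_fixed_point[OF s, of y] dist by (simp add: V)
qed

section \<open>Branching search over sets of bounded size\<close>

text \<open>With \<open>A\<close> in both places this says that \<open>A\<close> contains a bad pair
  of \<open>g\<close>; the conditional lets evaluation stop at the first one.\<close>

primrec spoiled :: "('e \<Rightarrow> 'e) \<Rightarrow> 'e list \<Rightarrow> 'e list \<Rightarrow> bool" where
  "spoiled g [] A \<longleftrightarrow> False"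
| "spoiled g (e # es) A \<longleftrightarrow> (if g e \<in> set A then True else spoiled g es A)"

lemma spoiled_iff: "spoiled g es A \<longleftrightarrow> (\<exists>e\<in>set es. g e \<in> set A)"
  by (induction es) auto

text \<open>
  In a successful search, every set containing \<open>A\<close> and at most \<open>b\<close> further elements
  avoids some map \<open>g\<close> of the list. The second component of a list entry holds enough elements \<open>e\<close>
  to represent all bad pairs \<open>{e, g e}\<close>. The nested conditionals keep evaluation lazy.
\<close>

fun search :: "nat \<Rightarrow> (('e \<Rightarrow> 'e) \<times> 'e list) list \<Rightarrow> 'e list \<Rightarrow> bool" where
  "search b [] A \<longleftrightarrow> False"
| "search b ((g, R) # ms) A \<longleftrightarrow>
    (if spoiled g A A then search b ms A
     else case b of
       0 \<Rightarrow> True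
     | Suc b' \<Rightarrow> list_all (\<lambda>e.
         if e \<in> set A then search b' ms (g e # A)
         else if g e \<in> set A then search b' ms (e # A)
         else case b' of
           0 \<Rightarrow> True
         | Suc b'' \<Rightarrow> search b'' ms (e # g e # A)) R)"

lemma card_Diff_set_Cons_le:
  assumes "card (D - set A) \<le> Suc b" "e \<in> D" "e \<notin> set A"
  shows "card (D - set (e # A)) \<le> b"
proof -
  have "D - set (e # A) = (D - set A) - {e}" by auto
  with assms show ?thesis by simp
qed

text \<open>If the head map fails for \<open>D\<close>, some \<open>e\<close> in \<open>R\<close>
  has both \<open>e\<close> and \<open>g e\<close> in \<open>D\<close>. The branch for
  \<open>e\<close> enlarges \<open>A\<close> inside \<open>D\<close>, and each new element costs one
  unit of the budget.\<close>

lemma search_sound: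
  assumes "search b ms A" "set A \<subseteq> D" "finite D" "card (D - set A) \<le> b"
    and "\<And>g R. (g, R) \<in> set ms \<Longrightarrow> \<exists>e\<in>D. g e \<in> D \<Longrightarrow> \<exists>e\<in>set R. e \<in> D \<and> g e \<in> D"
    and "\<And>g R e. (g, R) \<in> set ms \<Longrightarrow> e \<in> D \<Longrightarrow> g e \<noteq> e"
  shows "\<exists>(g, R)\<in>set ms. \<forall>e\<in>D. g e \<notin> D"
  using assms
proof (induction b ms A rule: search.induct)
  case (2 b g R ms A)
  have cover: "\<exists>e\<in>set R'. e \<in> D \<and> g' e \<in> D" if "(g', R') \<in> set ms" "\<exists>e\<in>D. g' e \<in> D" for g' R'
    using "2.prems"(5)[of g' R'] that by simp
  have moved: "g' e \<noteq> e" if "(g', R') \<in> set ms" "e \<in> D" for g' R' e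
    using "2.prems"(6)[of g' R' e] that by simp
  show ?case
  proof (cases "\<forall>e\<in>D. g e \<notin> D")
    case False
    then obtain e where e: "e \<in> set R" "e \<in> D" "g e \<in> D"
      using "2.prems"(5)[of g R] by auto
    then have ne: "g e \<noteq> e" using "2.prems"(6)[of g R e] by simp
    have "\<exists>(g, R)\<in>set ms. \<forall>e\<in>D. g e \<notin> D"
    proof (cases "spoiled g A A")
      case True
      then show ?thesis
        using "2.IH"(1) "2.prems"(1-4) cover moved by simp
    next
      case ns: False
      \<comment> \<open>At least one element of the pair is new, so the case of an exhausted budget,
        where the search returns \<open>True\<close>, cannot arise here.\<close>
      have "\<not> (e \<in> set A \<and> g e \<in> set A)" using ns by (auto simp: spoiled_iff)
      then have "D - set A \<noteq> {}" using e by blast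
      then have "b \<noteq> 0" using "2.prems"(3,4) by auto
      then obtain b' where b': "b = Suc b'" by (cases b) auto
      have card: "card (D - set A) \<le> Suc b'" using "2.prems"(4) b' by simp
      let ?step = "\<lambda>e. if e \<in> set A then search b' ms (g e # A)
         else if g e \<in> set A then search b' ms (e # A)
         else case b' of 0 \<Rightarrow> True | Suc b'' \<Rightarrow> search b'' ms (e # g e # A)"
      have step: "?step e"
        using "2.prems"(1) ns b' e(1) by (simp add: list_all_iff)
      show ?thesis
      proof (cases "e \<in> set A")
        case True
        with ns have "g e \<notin> set A" by (auto simp: spoiled_iff)
        with True step show ?thesis
          using "2.IH"(2)[OF ns b' e(1) True] "2.prems"(2,3) e cover moved
            card_Diff_set_Cons_le[OF card] by simp
      next
        case eA: False
        show ?thesis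
        proof (cases "g e \<in> set A")
          case True
          with eA step show ?thesis
            using "2.IH"(3)[OF ns b' e(1) eA True] "2.prems"(2,3) e cover moved
              card_Diff_set_Cons_le[OF card e(2) eA] by simp
        next
          case gA: False
          have c1: "card (D - set (g e # A)) \<le> b'"
            by (rule card_Diff_set_Cons_le[OF card e(3) gA])
          \<comment> \<open>Since \<open>g\<close> moves \<open>e\<close>, two missing elements
            really cost two units.\<close>
          have e': "e \<notin> set (g e # A)" using eA ne by simp
          then have "D - set (g e # A) \<noteq> {}" using e(2) by blast
          then have "b' \<noteq> 0" using c1 "2.prems"(3) by auto
          then obtain b'' where b'': "b' = Suc b''" by (cases b') auto
          have "card (D - set (e # g e # A)) \<le> b''"
            using c1 b'' card_Diff_set_Cons_le[OF _ e(2) e'] by simp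
          moreover have "search b'' ms (e # g e # A)" using step eA gA b'' by simp
          ultimately show ?thesis
            using "2.IH"(4)[OF ns b' e(1) eA gA b''] "2.prems"(2,3) e cover moved by simp
        qed
      qed
    qed
    then show ?thesis by auto
  qed auto
qed simp

text \<open>Elements swapped by \<open>g\<close> yield the same bad pair, so only the later one is
  kept. For an involution this halves the branching.\<close>

fun reps :: "('e \<Rightarrow> 'e) \<Rightarrow> 'e list \<Rightarrow> 'e list" where
  "reps g [] = []"
| "reps g (e # es) = (if g e \<in> set es \<and> g (g e) = e then reps g es else e # reps g es)"

lemma reps_cover:
  assumes "e \<in> set es" "e \<in> D" "g e \<in> D"
  shows "\<exists>e'\<in>set (reps g es). e' \<in> D \<and> g e' \<in> D"
  using assms
proof (induction es arbitrary: e)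
  case (Cons a es)
  then show ?case by (metis list.set_intros(1) list.set_intros(2) reps.simps(2) set_ConsD)
qed auto

section \<open>The permutations of six vertices and the search runs\<close>

datatype vtx = V0 | V1 | V2 | V3 | V4 | V5

definition vtxs :: "vtx list" where
  "vtxs = [V0, V1, V2, V3, V4, V5]"

lemma set_vtxs: "set vtxs = UNIV"
proof -
  have "v \<in> set vtxs" for v by (cases v) (simp_all add: vtxs_def)
  then show ?thesis by blast
qed

definition vtx_arcs :: "(vtx \<times> vtx) list" where
  "vtx_arcs = filter (\<lambda>(u, v). u \<noteq> v) (List.product vtxs vtxs)"

lemma set_vtx_arcs: "set vtx_arcs = {(u, v). u \<noteq> v}"
  by (auto simp: vtx_arcs_def set_vtxs)

text \<open>
  All 15 permutations of cycle type 2+2+2, followed by seven of type 4+2. The involutions alone do not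
  suffice: each of them is spoiled by the bidirected triangle together with a disjoint arc. The seven
  were found by a computer search.
\<close>

definition perms :: "(vtx \<Rightarrow> vtx) list" where
  "perms =
    [case_vtx V1 V0 V3 V2 V5 V4,
     case_vtx V1 V0 V4 V5 V2 V3,
     case_vtx V1 V0 V5 V4 V3 V2,
     case_vtx V2 V3 V0 V1 V5 V4,
     case_vtx V2 V4 V0 V5 V1 V3,
     case_vtx V2 V5 V0 V4 V3 V1,
     case_vtx V3 V2 V1 V0 V5 V4,
     case_vtx V3 V4 V5 V0 V1 V2,
     case_vtx V3 V5 V4 V0 V2 V1,
     case_vtx V4 V2 V1 V5 V0 V3,
     case_vtx V4 V3 V5 V1 V0 V2,
     case_vtx V4 V5 V3 V2 V0 V1,
     case_vtx V5 V2 V1 V4 V3 V0,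
     case_vtx V5 V3 V4 V1 V2 V0,
     case_vtx V5 V4 V3 V2 V1 V0,
     case_vtx V1 V3 V5 V4 V0 V2,
     case_vtx V1 V3 V0 V2 V5 V4,
     case_vtx V2 V3 V0 V5 V1 V4,
     case_vtx V1 V2 V5 V4 V3 V0,
     case_vtx V1 V2 V4 V5 V0 V3,
     case_vtx V2 V3 V4 V1 V5 V0,
     case_vtx V2 V4 V5 V0 V1 V3]"

lemma perms_order4: "list_all (\<lambda>p. list_all (\<lambda>v. p (p (p (p v))) = v) vtxs) perms"
  by code_simp

lemma perms_no_fixed_arc: "list_all (\<lambda>p. list_all (\<lambda>(u, v). p u \<noteq> u \<or> p v \<noteq> v) vtx_arcs) perms"
  by code_simp

definition moves :: "((vtx \<times> vtx \<Rightarrow> vtx \<times> vtx) \<times> (vtx \<times> vtx) list) list" where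
  "moves = map (\<lambda>p. (map_prod p p, reps (map_prod p p) vtx_arcs)) perms"

text \<open>A bad pair of a fixed-point-free involution consists of two opposite or two disjoint
  arcs. Up to relabelling, these two starts therefore suffice; they leave five of the seven
  arcs.\<close>

lemma search_moves_opposite: "search 5 moves [(V0, V1), (V1, V0)]"
  by code_simp

lemma search_moves_disjoint: "search 5 moves [(V0, V1), (V2, V3)]"
  by code_simp

lemma ex_good_perm:
  assumes E: "E \<subseteq> {(u, v). u \<noteq> v}" "card E \<le> 7"
    and start: "{(V0, V1), (V1, V0)} \<subseteq> E \<or> {(V0, V1), (V2, V3)} \<subseteq> E"
  shows "\<exists>p\<in>set perms. \<forall>e\<in>E. map_prod p p e \<notin> E"
proof -
  have fin: "finite E"
    using finite_set[of vtx_arcs] E(1) unfolding set_vtx_arcs by (rule rev_finite_subset)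
  obtain A where A: "search 5 moves A" "set A \<subseteq> E" "card (set A) = 2"
    using start search_moves_opposite search_moves_disjoint
    by (elim disjE) (auto intro: that[of "[_, _]"])
  have "\<exists>(g, R)\<in>set moves. \<forall>e\<in>E. g e \<notin> E"
  proof (rule search_sound[OF A(1,2) fin])
    show "card (E - set A) \<le> 5"
      using A E(2) fin by (subst card_Diff_subset) auto
    show "\<exists>e\<in>set R. e \<in> E \<and> g e \<in> E" if gR: "(g, R) \<in> set moves" and ex: "\<exists>e\<in>E. g e \<in> E" for g R
    proof -
      obtain e where e: "e \<in> E" "g e \<in> E" using ex by blast
      moreover have "R = reps g vtx_arcs" using gR by (auto simp: moves_def)
      moreover have "e \<in> set vtx_arcs" using e E(1) by (auto simp: set_vtx_arcs)
      ultimately show ?thesis using reps_cover by metis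
    qed
    show "g e \<noteq> e" if gR: "(g, R) \<in> set moves" and e: "e \<in> E" for g R e
    proof -
      obtain p where p: "p \<in> set perms" "g = map_prod p p"
        using gR by (auto simp: moves_def)
      moreover have "e \<in> set vtx_arcs" using e E(1) by (auto simp: set_vtx_arcs)
      ultimately show ?thesis
        using perms_no_fixed_arc by (cases e) (auto simp: list_all_iff)
    qed
  qed
  then show ?thesis by (auto simp: moves_def)
qed

section \<open>Transfer to arbitrary six-vertex digraphs\<close>

lemma completable_if_good_perm:
  assumes D: "pair_digraph D" and f: "inj f" "range f = pverts D"
    and p: "p \<in> set perms" and good: "\<And>u v. (f u, f v) \<in> parcs D \<Longrightarrow> (f (p u), f (p v)) \<notin> parcs D"
  shows "completable D"
proof -
  interpret pair_digraph D by fact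
  define s where "s = f \<circ> p \<circ> inv f"
  have sf: "s (f i) = f (p i)" for i using f(1) by (simp add: s_def)
  have onto: "\<exists>i. v = f i" if "v \<in> pverts D" for v using that f(2) by auto
  have p4: "p (p (p (p i))) = i" for i
    using perms_order4 p by (auto simp: list_all_iff set_vtxs)
  have p_moves: "p i \<noteq> i \<or> p j \<noteq> j" if "i \<noteq> j" for i j
    using perms_no_fixed_arc p that by (auto simp: list_all_iff set_vtx_arcs)
  show ?thesis
  proof (rule completable_if_order4[OF D, where s = s])
    show "s v \<in> pverts D" for v
      unfolding s_def f(2)[symmetric] by simp
    show "s (s (s (s v))) = v" if "v \<in> pverts D" for v
      using onto[OF that] by (auto simp: sf p4)
    show "s u \<noteq> u \<or> s v \<noteq> v" if uv: "u \<in> pverts D" "v \<in> pverts D" "u \<noteq> v" for u v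
    proof -
      obtain i j where ij: "u = f i" "v = f j"
        using onto[OF uv(1)] onto[OF uv(2)] by blast
      then have "i \<noteq> j" using uv(3) by auto
      from p_moves[OF this] show ?thesis unfolding ij sf inj_eq[OF f(1)] .
    qed
    show "(s u, s v) \<notin> parcs D" if "(u, v) \<in> parcs D" for u v
      using onto[OF in_arcsD1[OF that]] onto[OF in_arcsD2[OF that]] that good
      by (auto simp: sf)
  qed
qed

text \<open>Allows chosen vertices to be labelled \<open>V0\<close>, \<open>V1\<close>, and so on,
  as the starts of the searches require.\<close>

lemma ex_vtx_enumeration:
  assumes "card V = 6" "distinct ys" "set ys \<subseteq> V"
  shows "\<exists>f. inj f \<and> range f = V \<and> map f (take (length ys) vtxs) = ys"
proof -
  have "finite V" using assms(1) card.infinite by fastforce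
  then obtain zs where zs: "set zs = V - set ys" "distinct zs"
    using finite_distinct_list[of "V - set ys"] by auto
  define xs where "xs = ys @ zs"
  have d: "distinct xs" and s: "set xs = V" using zs assms by (auto simp: xs_def)
  then have "length xs = 6" using assms(1) distinct_card by metis
  then obtain a b c d e g where xs: "xs = [a, b, c, d, e, g]"
    by (auto simp: length_Suc_conv numeral_eq_Suc)
  let ?f = "case_vtx a b c d e g"
  have m: "map ?f vtxs = xs" by (simp add: vtxs_def xs)
  have "map ?f (take (length ys) vtxs) = ys"
    unfolding take_map[symmetric] m by (simp add: xs_def)
  moreover have "range ?f = V"
    using s m by (metis set_vtxs set_map)
  moreover have "inj ?f"
    using d m by (metis distinct_map set_vtxs)
  ultimately show ?thesis by blast
qed

lemma completable_if_card_le_7: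
  fixes D :: "'a pair_pre_digraph"
  assumes D: "pair_digraph D" and V: "card (pverts D) = 6" and arcs: "card (parcs D) \<le> 7"
  shows "completable D"
proof -
  interpret pair_digraph D by fact
  have start: "completable D"
    if f: "inj f" "range f = pverts D" and s: "(f V0, f V1) \<in> parcs D"
      "(f V1, f V0) \<in> parcs D \<or> (f V2, f V3) \<in> parcs D" for f
  proof -
    let ?E = "{(u, v). (f u, f v) \<in> parcs D}"
    have "inj_on (map_prod f f) ?E"
      \<comment> \<open>Injectivity keeps the number of arcs at most seven after
        relabelling.\<close>
      using f(1) by (meson inj_on_subset map_prod_inj_on subset_UNIV prod.inj_map)
    moreover have "map_prod f f ` ?E \<subseteq> parcs D" by auto
    ultimately have "card ?E \<le> card (parcs D)"
      using pair_finite_arcs card_inj_on_le by blast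
    then obtain p where "p \<in> set perms" "\<forall>e\<in>?E. map_prod p p e \<notin> ?E"
      using ex_good_perm[of ?E] s arcs pair_no_loops by fastforce
    with D f show ?thesis by (intro completable_if_good_perm) auto
  qed
  consider (opp) a b where "(a, b) \<in> parcs D" "(b, a) \<in> parcs D"
    | (disj) a b c d where "(a, b) \<in> parcs D" "(c, d) \<in> parcs D" "distinct [a, b, c, d]"
    | (none) "\<And>a b. (a, b) \<in> parcs D \<Longrightarrow> (b, a) \<notin> parcs D"
        "\<And>a b c d. (a, b) \<in> parcs D \<Longrightarrow> distinct [a, b, c, d] \<Longrightarrow> (c, d) \<notin> parcs D"
    by blast
  then show ?thesis
  proof cases
    case opp
    then have ab: "distinct [a, b]" "set [a, b] \<subseteq> pverts D"
      using pair_no_loops[of "(a, b)"] in_arcsD1[of a b] in_arcsD2[of a b] by auto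
    then obtain f where "inj f" "range f = pverts D" "map f (take (length [a, b]) vtxs) = [a, b]"
      using ex_vtx_enumeration[OF V ab] by (elim exE conjE)
    with opp start[of f] show ?thesis by (simp add: vtxs_def)
  next
    case disj
    then have abcd: "set [a, b, c, d] \<subseteq> pverts D"
      using in_arcsD1[of a b] in_arcsD2[of a b] in_arcsD1[of c d] in_arcsD2[of c d] by auto
    then obtain f where "inj f" "range f = pverts D"
      "map f (take (length [a, b, c, d]) vtxs) = [a, b, c, d]"
      using ex_vtx_enumeration[OF V disj(3) abcd] by (elim exE conjE)
    with disj start[of f] show ?thesis by (simp add: vtxs_def)
  next
    case none
    obtain f :: "vtx \<Rightarrow> 'a" where f: "inj f" "range f = pverts D"
      using ex_vtx_enumeration[OF V, of "[]"] by auto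
    \<comment> \<open>Without opposite or disjoint arcs, no fixed-point-free involution has a bad
      pair; the first permutation of the list serves.\<close>
    let ?p = "case_vtx V1 V0 V3 V2 V5 V4"
    show ?thesis
    proof (rule completable_if_good_perm[OF D f])
      show "?p \<in> set perms" by (simp add: perms_def)
      show "(f (?p u), f (?p v)) \<notin> parcs D" if "(f u, f v) \<in> parcs D" for u v
      proof -
        have "u \<noteq> v" using pair_no_loops[OF that] by auto
        then have "?p u = v \<and> ?p v = u \<or> distinct [u, v, ?p u, ?p v]"
          by (cases u; cases v; simp)
        then show ?thesis
        proof
          assume "?p u = v \<and> ?p v = u"
          with none(1)[OF that] show ?thesis by simp
        next
          assume "distinct [u, v, ?p u, ?p v]"
          then have "distinct [f u, f v, f (?p u), f (?p v)]"
            using f(1) by (simp add: inj_eq)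
          with that show ?thesis by (rule none(2))
        qed
      qed
    qed
  qed
qed

section \<open>The value for six vertices\<close>

lemma triangle_path_basic:
  assumes "distinct [a, b, c, x, y, z]"
  shows "pair_digraph (triangle_path a b c x y z)"
    and "card (pverts (triangle_path a b c x y z)) = 6"
    and "card (parcs (triangle_path a b c x y z)) = 8"
proof -
  show "pair_digraph (triangle_path a b c x y z)"
    using assms by unfold_locales (auto simp: triangle_path_def)
  have "pverts (triangle_path a b c x y z) = set [a, b, c, x, y, z]"
    by (auto simp: triangle_path_def)
  then show "card (pverts (triangle_path a b c x y z)) = 6"
    using distinct_card[OF assms] by simp
  let ?arcs = "[(a, b), (b, a), (a, c), (c, a), (b, c), (c, b), (x, y), (y, z)]"
  have "parcs (triangle_path a b c x y z) = set ?arcs"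
    by (auto simp: triangle_path_def)
  moreover have "distinct ?arcs" using assms by auto
  ultimately show "card (parcs (triangle_path a b c x y z)) = 8"
    using distinct_card[of ?arcs] by simp
qed

theorem theorem1p1:
  shows "c_sc 6 = 7 \<and>
    (\<forall>a b c x y z :: 'a. distinct [a, b, c, x, y, z] \<longrightarrow>
      pair_digraph (triangle_path a b c x y z) \<and>
      card (pverts (triangle_path a b c x y z)) = 6 \<and>
      card (parcs (triangle_path a b c x y z)) = 8 \<and>
      \<not> completable (triangle_path a b c x y z))"
proof
  let ?S = "{q. \<forall>D :: nat pair_pre_digraph.
     pair_digraph D \<and> card (pverts D) = 6 \<and> card (parcs D) \<le> q \<longrightarrow> completable D}"
  have "7 \<in> ?S" using completable_if_card_le_7 by blast
  moreover have le: "q \<le> 7" if "q \<in> ?S" for q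
  proof (rule ccontr)
    \<comment> \<open>Such a \<open>q\<close> is at least 8 and so admits the eight-arc triangle
      with a path on 0, ..., 5.\<close>
    assume "\<not> q \<le> 7"
    moreover have "distinct [0, 1, 2, 3, 4, 5 :: nat]" by simp
    ultimately show False
      using that triangle_path_basic[of 0 1 2 3 4 "5 :: nat"]
        not_completable_triangle_path[of 0 1 2 3 4 "5 :: nat"] by auto
  qed
  moreover have "finite ?S"
    using le by (meson finite_nat_set_iff_bounded_le)
  ultimately show "c_sc 6 = 7"
    unfolding c_sc_def by (intro Max_eqI) auto
next
  show "\<forall>a b c x y z :: 'a. distinct [a, b, c, x, y, z] \<longrightarrow>
      pair_digraph (triangle_path a b c x y z) \<and>
      card (pverts (triangle_path a b c x y z)) = 6 \<and>
      card (parcs (triangle_path a b c x y z)) = 8 \<and>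
      \<not> completable (triangle_path a b c x y z)"
    by (intro allI impI conjI; rule triangle_path_basic not_completable_triangle_path; assumption)
qed

end
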